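(* Let $X$ be a partially ordered vector space and let $i\in\{1,2,3\}$. Then the following statements are equivalent. (i) $X$ is Archimedean and directed. (ii) For every net $(\lambda_\alpha)_{\alpha\in A}$ in $\mathbb R$ with $\lambda_\alpha\xrightarrow{o_i}\lambda\in\mathbb R$ and every net $(x_\beta)_{\beta\in B}$ in $X$ with $x_\beta\xrightarrow{o_i}x\in X$ the net $(\lambda_\alpha x_\beta)_{(\alpha,\beta)\in A\times B}$ satisfies $\lambda_\alpha x_\beta\xrightarrow{o_i}\lambda x$ (where $A\times B$ is ordered component-wise). (iii) For every net $(\lambda_\alpha)_{\alpha\in A}$ in $\mathbb R$ with $\lambda_\alpha\xrightarrow{o_i}\lambda\in\mathbb R$ and every net $(x_\alpha)_{\alpha\in A}$ in $X$ with $x_\alpha\xrightarrow{o_i}x\in X$ the net $(\lambda_\alpha x_\alpha)_{\alpha\in A}$ satisfies $\lambda_\alpha x_\alpha\xrightarrow{o_i}\lambda x$.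
   Context: Nets are indexed by non-empty upward directed partially ordered sets. For a net in a partially ordered set $P$, $x_\alpha\downarrow x$ means that $x_\alpha\le x_\beta$ whenever $\alpha\ge\beta$ and $\inf_\alpha x_\alpha=x$; $x_\alpha\uparrow x$ is defined dually. $A_{\ge\alpha_0}:=\{\alpha\in A;\ \alpha\ge\alpha_0\}$. Order convergence in a partially ordered set $P$, for a net $(x_\alpha)_{\alpha\in A}$ in $P$ and $x\in P$: - $x_\alpha\xrightarrow{o_1}x$ if there are nets $(\hat x_\alpha)_{\alpha\in A}$, $(\check x_\alpha)_{\alpha\in A}$ in $P$ with $\hat x_\alpha\uparrow x$, $\check x_\alpha\downarrow x$ and $\hat x_\alpha\le x_\alpha\le\check x_\alpha$ for all $\alpha\in A$. - $x_\alpha\xrightarrow{o_2}x$ if there are such nets $(\hat x_\alpha)_{\alpha\in A}$, $(\check x_\alpha)_{\alpha\in A}$ with $\hat x_\alpha\uparrow x$, $\check x_\alpha\downarrow x$, and $\alpha_0\in A$ with $\hat x_\alpha\le x_\alpha\le\check x_\alpha$ for all $\alpha\in A_{\ge\alpha_0}$. - $x_\alpha\xrightarrow{o_3}x$ if there are nets $(\hat x_\beta)_{\beta\in B}$, $(\check x_\gamma)_{\gamma\in C}$ in $P$ and a map $\eta\colon B\times C\to A$ with $\hat x_\beta\uparrow x$, $\check x_\gamma\downarrow x$ and $\hat x_\beta\le x_\alpha\le\check x_\gamma$ for all $\beta\in B$, $\gamma\in C$, $\alpha\in A_{\ge\eta(\beta,\gamma)}$. A partially ordered vector space is a real vector space with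 a translation invariant partial order such that $\lambda x\ge0$ whenever $\lambda\in\mathbb R$, $\lambda\ge0$ and $x\ge0$. $X$ is directed if any two elements have a common upper bound. $X$ is Archimedean if for all $x,y\in X$ with $nx\le y$ for all $n\in\mathbb N$ one has $x\le0$. $\mathbb R$ carries its standard order. *)

theory Defs
  imports Complex_Main "HOL-Library.Lub_Glb"
begin

text \<open>
  The index set of a net is a carrier set \<open>A\<close> together with an order relation \<open>r\<close>, where
  \<open>(a, b) \<in> r\<close> means \<open>a \<le> b\<close>. A net is a function of which only the values on \<open>A\<close> matter.
\<close>

definition index_poset :: "'i set \<Rightarrow> 'i rel \<Rightarrow> bool" where
  "index_poset A r \<longleftrightarrow>
     A \<noteq> {} \<and> partial_order_on A r \<and> (\<forall>a\<in>A. \<forall>b\<in>A. \<exists>c\<in>A. (a, c) \<in> r \<and> (b, c) \<in> r)"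

definition prod_order :: "'i rel \<Rightarrow> 'j rel \<Rightarrow> ('i \<times> 'j) rel" where
  "prod_order r s = {((a, b), (a', b')). (a, a') \<in> r \<and> (b, b') \<in> s}"

lemma index_poset_prod:
  assumes "index_poset A r" "index_poset B s"
  shows "index_poset (A \<times> B) (prod_order r s)"
proof -
  have r: "r \<subseteq> A \<times> A" "refl_on A r" "trans r" "antisym r"
    and s: "s \<subseteq> B \<times> B" "refl_on B s" "trans s" "antisym s"
    using assms by (auto simp: index_poset_def order_on_defs)
  have "prod_order r s \<subseteq> (A \<times> B) \<times> (A \<times> B)"
    using r(1) s(1) by (auto simp: prod_order_def)
  moreover have "refl_on (A \<times> B) (prod_order r s)"
    using r(2) s(2) by (auto simp: prod_order_def refl_on_def)
  moreover have "trans (prod_order r s)"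
    by (rule transI) (auto simp: prod_order_def intro: transD[OF r(3)] transD[OF s(3)])
  moreover have "antisym (prod_order r s)"
    by (rule antisymI) (auto simp: prod_order_def intro: antisymD[OF r(4)] antisymD[OF s(4)])
  moreover have "\<exists>c\<in>A \<times> B. (p, c) \<in> prod_order r s \<and> (q, c) \<in> prod_order r s"
    if pq: "p \<in> A \<times> B" "q \<in> A \<times> B" for p q
  proof -
    obtain c where "c \<in> A" "(fst p, c) \<in> r" "(fst q, c) \<in> r"
      using assms(1) pq unfolding index_poset_def by (metis mem_Times_iff)
    moreover obtain d where "d \<in> B" "(snd p, d) \<in> s" "(snd q, d) \<in> s"
      using assms(2) pq unfolding index_poset_def by (metis mem_Times_iff)
    ultimately show ?thesis
      by (intro bexI[of _ "(c, d)"]) (auto simp: prod_order_def split_beta)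
  qed
  ultimately show ?thesis
    using assms unfolding index_poset_def order_on_defs by auto
qed

definition net_down :: "'i set \<Rightarrow> 'i rel \<Rightarrow> ('i \<Rightarrow> 'p::order) \<Rightarrow> 'p \<Rightarrow> bool" where
  "net_down A r x l \<longleftrightarrow>
     (\<forall>a\<in>A. \<forall>b\<in>A. (b, a) \<in> r \<longrightarrow> x a \<le> x b) \<and> isGlb UNIV (x ` A) l"

definition net_up :: "'i set \<Rightarrow> 'i rel \<Rightarrow> ('i \<Rightarrow> 'p::order) \<Rightarrow> 'p \<Rightarrow> bool" where
  "net_up A r x l \<longleftrightarrow>
     (\<forall>a\<in>A. \<forall>b\<in>A. (b, a) \<in> r \<longrightarrow> x b \<le> x a) \<and> isLub UNIV (x ` A) l"

definition o1_conv :: "'i set \<Rightarrow> 'i rel \<Rightarrow> ('i \<Rightarrow> 'p::order) \<Rightarrow> 'p \<Rightarrow> bool" where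
  "o1_conv A r x l \<longleftrightarrow>
     (\<exists>lo up. net_up A r lo l \<and> net_down A r up l \<and> (\<forall>a\<in>A. lo a \<le> x a \<and> x a \<le> up a))"

definition o2_conv :: "'i set \<Rightarrow> 'i rel \<Rightarrow> ('i \<Rightarrow> 'p::order) \<Rightarrow> 'p \<Rightarrow> bool" where
  "o2_conv A r x l \<longleftrightarrow>
     (\<exists>lo up. net_up A r lo l \<and> net_down A r up l \<and>
        (\<exists>a0\<in>A. \<forall>a\<in>A. (a0, a) \<in> r \<longrightarrow> lo a \<le> x a \<and> x a \<le> up a))"

text \<open>
  HOL cannot quantify over the types of the auxiliary index sets \<open>B\<close> and \<open>C\<close>, so they are taken
  to be subsets of the type \<open>'p\<close> itself, with arbitrary order relations. The lemma
  \<open>o3_convI\<close> below shows that index sets from any other types give nothing more.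
\<close>

definition o3_conv :: "'i set \<Rightarrow> 'i rel \<Rightarrow> ('i \<Rightarrow> 'p::order) \<Rightarrow> 'p \<Rightarrow> bool" where
  "o3_conv A r x l \<longleftrightarrow>
     (\<exists>(B :: 'p set) s (C :: 'p set) t lo up \<eta>.
        index_poset B s \<and> index_poset C t \<and> net_up B s lo l \<and> net_down C t up l \<and>
        (\<forall>b\<in>B. \<forall>c\<in>C. \<eta> (b, c) \<in> A \<and>
           (\<forall>a\<in>A. (\<eta> (b, c), a) \<in> r \<longrightarrow> lo b \<le> x a \<and> x a \<le> up c)))"

lemma o3_convI:
  fixes B :: "'b set" and C :: "'c set" and x :: "'i \<Rightarrow> 'p::order"
  assumes B: "index_poset B s" and C: "index_poset C t"
    and lo: "net_up B s lo l" and up: "net_down C t up l"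
    and \<eta>: "\<forall>b\<in>B. \<forall>c\<in>C. \<eta> (b, c) \<in> A \<and>
           (\<forall>a\<in>A. (\<eta> (b, c), a) \<in> r \<longrightarrow> lo b \<le> x a \<and> x a \<le> up c)"
  shows "o3_conv A r x l"
proof -
  define s' where "s' = {(p, q). p \<in> lo ` B \<and> q \<in> lo ` B \<and> p \<le> q}"
  define t' where "t' = {(p, q). p \<in> up ` C \<and> q \<in> up ` C \<and> q \<le> p}"
  define \<eta>' where "\<eta>' = (\<lambda>(p, q). \<eta> (inv_into B lo p, inv_into C up q))"
  have s'_po: "partial_order_on (lo ` B) s'"
    unfolding s'_def order_on_defs refl_on_def trans_def antisym_def by (auto intro: order_trans)
  have t'_po: "partial_order_on (up ` C) t'"
    unfolding t'_def order_on_defs refl_on_def trans_def antisym_def by (auto intro: order_trans)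
  have s'_dir: "\<exists>c\<in>lo ` B. (p, c) \<in> s' \<and> (q, c) \<in> s'" if pq: "p \<in> lo ` B" "q \<in> lo ` B" for p q
  proof -
    obtain a b where "a \<in> B" "b \<in> B" "p = lo a" "q = lo b" using pq by auto
    moreover then obtain c where "c \<in> B" "(a, c) \<in> s" "(b, c) \<in> s"
      using B unfolding index_poset_def by blast
    ultimately show ?thesis using lo unfolding net_up_def s'_def by blast
  qed
  have t'_dir: "\<exists>c\<in>up ` C. (p, c) \<in> t' \<and> (q, c) \<in> t'" if pq: "p \<in> up ` C" "q \<in> up ` C" for p q
  proof -
    obtain a b where "a \<in> C" "b \<in> C" "p = up a" "q = up b" using pq by auto
    moreover then obtain c where "c \<in> C" "(a, c) \<in> t" "(b, c) \<in> t"
      using C unfolding index_poset_def by blast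
    ultimately show ?thesis using up unfolding net_down_def t'_def by blast
  qed
  have "index_poset (lo ` B) s'" "index_poset (up ` C) t'"
    using B C s'_po t'_po s'_dir t'_dir unfolding index_poset_def by auto
  moreover have "net_up (lo ` B) s' id l" "net_down (up ` C) t' id l"
    using lo up unfolding net_up_def net_down_def s'_def t'_def by auto
  moreover have "\<forall>p\<in>lo ` B. \<forall>q\<in>up ` C. \<eta>' (p, q) \<in> A \<and>
           (\<forall>a\<in>A. (\<eta>' (p, q), a) \<in> r \<longrightarrow> id p \<le> x a \<and> x a \<le> id q)"
  proof (intro ballI)
    fix p q assume p: "p \<in> lo ` B" and q: "q \<in> up ` C"
    show "\<eta>' (p, q) \<in> A \<and> (\<forall>a\<in>A. (\<eta>' (p, q), a) \<in> r \<longrightarrow> id p \<le> x a \<and> x a \<le> id q)"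
      using \<eta>[rule_format, OF inv_into_into[OF p] inv_into_into[OF q]]
      by (simp add: \<eta>'_def f_inv_into_f[OF p] f_inv_into_f[OF q])
  qed
  ultimately show ?thesis unfolding o3_conv_def by blast
qed

definition order_conv :: "nat \<Rightarrow> 'i set \<Rightarrow> 'i rel \<Rightarrow> ('i \<Rightarrow> 'p::order) \<Rightarrow> 'p \<Rightarrow> bool" where
  "order_conv i A r x l \<longleftrightarrow>
     (i = 1 \<and> o1_conv A r x l) \<or> (i = 2 \<and> o2_conv A r x l) \<or> (i = 3 \<and> o3_conv A r x l)"

text \<open>
  The class \<open>ordered_real_vector\<close> is that of partially ordered vector spaces; its second
  monotonicity axiom follows from the first and translation invariance.
\<close>

definition archimedean_pov :: "'a::ordered_real_vector itself \<Rightarrow> bool" where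
  "archimedean_pov _ \<longleftrightarrow> (\<forall>x y :: 'a. (\<forall>n::nat. real n *\<^sub>R x \<le> y) \<longrightarrow> x \<le> 0)"

text \<open>It is immaterial whether the natural numbers start at 0 or at 1.\<close>

lemma archimedean_pov_iff_pos:
  "archimedean_pov TYPE('a::ordered_real_vector) \<longleftrightarrow>
     (\<forall>x y :: 'a. (\<forall>n\<ge>1. real n *\<^sub>R x \<le> y) \<longrightarrow> x \<le> 0)"
proof
  assume arch: "archimedean_pov TYPE('a)"
  show "\<forall>x y :: 'a. (\<forall>n\<ge>1. real n *\<^sub>R x \<le> y) \<longrightarrow> x \<le> 0"
  proof (intro allI impI)
    fix x y :: 'a assume *: "\<forall>n\<ge>1. real n *\<^sub>R x \<le> y"
    have "real n *\<^sub>R x \<le> y - x" for n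
      using *[rule_format, of "Suc n"] by (simp add: scaleR_left_distrib algebra_simps)
    then show "x \<le> 0" using arch unfolding archimedean_pov_def by blast
  qed
qed (auto simp: archimedean_pov_def)

definition directed_pov :: "'a::ordered_real_vector itself \<Rightarrow> bool" where
  "directed_pov _ \<longleftrightarrow> (\<forall>x y :: 'a. \<exists>z. x \<le> z \<and> y \<le> z)"

end

theory Submission
  imports Defs
begin

text \<open>
  In a partially ordered vector space each mode of order convergence \<open>x\<^sub>\<alpha> \<rightarrow> y\<close> amounts to
  \<open>y - w \<le> x\<^sub>\<alpha> \<le> y + w\<close> for a single net \<open>w \<down> 0\<close>, over the index set and for the \<open>\<alpha>\<close>
  that the mode prescribes. If \<open>m \<down> 0\<close> and \<open>u \<down> 0\<close> are such
  bounds for scalars converging to \<open>l\<close> and for vectors converging to \<open>y\<close>, and \<open>-e \<le> y \<le> e\<close>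
  (such an \<open>e\<close> exists by directedness), then the products lie within \<open>m u + \<bar>l\<bar> u + m e\<close> of
  \<open>l y\<close>. For fixed \<open>u\<close> the Archimedean property lets \<open>m\<close> tend to zero, which leaves \<open>\<bar>l\<bar> u\<close>,
  and this decreases to zero.
  The diagonal statement follows from the product one by restricting to the diagonal.
  Conversely, convergence of \<open>x / n\<close> to zero for every \<open>x\<close> yields positive upper bounds of \<open>x\<close>,
  and \<open>n x \<le> y\<close> gives \<open>x \<le> y / n\<close>, which forces \<open>x \<le> 0\<close>.
\<close>

section \<open>Monotone nets and directed index sets in elementary form\<close>

lemma isGlb_UNIV_iff:
  "isGlb UNIV S (l :: 'p::order) \<longleftrightarrow> (\<forall>s\<in>S. l \<le> s) \<and> (\<forall>g. (\<forall>s\<in>S. g \<le> s) \<longrightarrow> g \<le> l)"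
  by (auto simp: isGlb_def greatestP_def isLb_def setge_def setle_def)

lemma isLub_UNIV_iff:
  "isLub UNIV S (l :: 'p::order) \<longleftrightarrow> (\<forall>s\<in>S. s \<le> l) \<and> (\<forall>g. (\<forall>s\<in>S. s \<le> g) \<longrightarrow> l \<le> g)"
  by (auto simp: isLub_def leastP_def isUb_def setge_def setle_def)

lemma net_down_iff:
  "net_down A r x l \<longleftrightarrow> (\<forall>a\<in>A. \<forall>b\<in>A. (b, a) \<in> r \<longrightarrow> x a \<le> x b) \<and>
     (\<forall>a\<in>A. l \<le> x a) \<and> (\<forall>g. (\<forall>a\<in>A. g \<le> x a) \<longrightarrow> g \<le> l)"
  by (auto simp: net_down_def isGlb_UNIV_iff)

lemma net_up_iff:
  "net_up A r x l \<longleftrightarrow> (\<forall>a\<in>A. \<forall>b\<in>A. (b, a) \<in> r \<longrightarrow> x b \<le> x a) \<and>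
     (\<forall>a\<in>A. x a \<le> l) \<and> (\<forall>g. (\<forall>a\<in>A. x a \<le> g) \<longrightarrow> l \<le> g)"
  by (auto simp: net_up_def isLub_UNIV_iff)

lemma index_posetD:
  assumes "index_poset A r"
  shows index_poset_nonempty: "A \<noteq> {}"
    and index_poset_refl: "a \<in> A \<Longrightarrow> (a, a) \<in> r"
    and index_poset_trans: "(a, b) \<in> r \<Longrightarrow> (b, c) \<in> r \<Longrightarrow> (a, c) \<in> r"
    and index_poset_upper: "a \<in> A \<Longrightarrow> b \<in> A \<Longrightarrow> \<exists>c\<in>A. (a, c) \<in> r \<and> (b, c) \<in> r"
  using assms unfolding index_poset_def order_on_defs refl_on_def trans_def by blast+

section \<open>Restriction of convergence to the diagonal of a product\<close>

lemma net_down_diag: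
  assumes "index_poset A r" and f: "net_down (A \<times> A) (prod_order r r) f l"
  shows "net_down A r (\<lambda>a. f (a, a)) l"
proof -
  have "g \<le> l" if g: "\<forall>a\<in>A. g \<le> f (a, a)" for g
  proof -
    \<comment> \<open>The diagonal is cofinal in \<open>A \<times> A\<close>: by directedness some
      \<open>(c, c)\<close> lies above \<open>(a, b)\<close>, and \<open>f\<close> decreases, so a
      lower bound of the diagonal values bounds every value.\<close>
    have "g \<le> f (a, b)" if ab: "a \<in> A" "b \<in> A" for a b
    proof -
      obtain c where c: "c \<in> A" "(a, c) \<in> r" "(b, c) \<in> r"
        using index_poset_upper[OF assms(1) ab] by blast
      then have "f (c, c) \<le> f (a, b)" using f ab unfolding net_down_iff prod_order_def by simp
      then show ?thesis using g c(1) by (meson order_trans)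
    qed
    then show ?thesis using f unfolding net_down_iff by auto
  qed
  then show ?thesis using f unfolding net_down_iff prod_order_def by auto
qed

lemma net_up_diag:
  assumes "index_poset A r" and f: "net_up (A \<times> A) (prod_order r r) f l"
  shows "net_up A r (\<lambda>a. f (a, a)) l"
proof -
  have "l \<le> g" if g: "\<forall>a\<in>A. f (a, a) \<le> g" for g
  proof -
    have "f (a, b) \<le> g" if ab: "a \<in> A" "b \<in> A" for a b
    proof -
      obtain c where c: "c \<in> A" "(a, c) \<in> r" "(b, c) \<in> r"
        using index_poset_upper[OF assms(1) ab] by blast
      then have "f (a, b) \<le> f (c, c)" using f ab unfolding net_up_iff prod_order_def by simp
      then show ?thesis using g c(1) by (meson order_trans)
    qed
    then show ?thesis using f unfolding net_up_iff by auto
  qed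
  then show ?thesis using f unfolding net_up_iff prod_order_def by auto
qed

lemma order_conv_diag:
  fixes f :: "'i \<times> 'i \<Rightarrow> 'p::order"
  assumes A: "index_poset A r" and f: "order_conv i (A \<times> A) (prod_order r r) f l"
  shows "order_conv i A r (\<lambda>a. f (a, a)) l"
proof -
  \<comment> \<open>Cofinality in the form used below: whatever holds from the pair \<open>p\<close>
    on holds along the diagonal from some \<open>c\<close> on.\<close>
  have upper: "\<exists>c\<in>A. \<forall>a\<in>A. (c, a) \<in> r \<longrightarrow> (p, (a, a)) \<in> prod_order r r" if p: "p \<in> A \<times> A" for p
  proof -
    obtain c where "c \<in> A" "(fst p, c) \<in> r" "(snd p, c) \<in> r"
      using index_poset_upper[OF A] p by (metis mem_Times_iff)
    then show ?thesis
      by (intro bexI[of _ c]) (auto simp: prod_order_def split_beta intro: index_poset_trans[OF A])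
  qed
  consider (1) "i = 1" "o1_conv (A \<times> A) (prod_order r r) f l"
    | (2) "i = 2" "o2_conv (A \<times> A) (prod_order r r) f l"
    | (3) "i = 3" "o3_conv (A \<times> A) (prod_order r r) f l"
    using f unfolding order_conv_def by blast
  then show ?thesis
  proof cases
    case 1
    then obtain lo up where *: "net_up (A \<times> A) (prod_order r r) lo l"
      "net_down (A \<times> A) (prod_order r r) up l" "\<forall>a\<in>A \<times> A. lo a \<le> f a \<and> f a \<le> up a"
      unfolding o1_conv_def by blast
    have "\<forall>a\<in>A. lo (a, a) \<le> f (a, a) \<and> f (a, a) \<le> up (a, a)" using *(3) by simp
    then have "o1_conv A r (\<lambda>a. f (a, a)) l"
      unfolding o1_conv_def using net_up_diag[OF A *(1)] net_down_diag[OF A *(2)] by blast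
    then show ?thesis using 1 by (simp add: order_conv_def)
  next
    case 2
    then obtain lo up p where *: "net_up (A \<times> A) (prod_order r r) lo l"
      "net_down (A \<times> A) (prod_order r r) up l" "p \<in> A \<times> A"
      "\<forall>a\<in>A \<times> A. (p, a) \<in> prod_order r r \<longrightarrow> lo a \<le> f a \<and> f a \<le> up a"
      unfolding o2_conv_def by blast
    obtain c where "c \<in> A" "\<forall>a\<in>A. (c, a) \<in> r \<longrightarrow> (p, (a, a)) \<in> prod_order r r"
      using upper[OF *(3)] by blast
    with *(4) have "\<forall>a\<in>A. (c, a) \<in> r \<longrightarrow> lo (a, a) \<le> f (a, a) \<and> f (a, a) \<le> up (a, a)"
      by simp
    then have "o2_conv A r (\<lambda>a. f (a, a)) l"
      unfolding o2_conv_def using \<open>c \<in> A\<close> net_up_diag[OF A *(1)] net_down_diag[OF A *(2)]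
      by blast
    then show ?thesis using 2 by (simp add: order_conv_def)
  next
    case 3
    then obtain B s C t lo up \<eta> where *: "index_poset (B :: 'p set) s"
      "index_poset (C :: 'p set) t" "net_up B s lo l" "net_down C t up l"
      "\<forall>b\<in>B. \<forall>c\<in>C. \<eta> (b, c) \<in> A \<times> A \<and> (\<forall>a\<in>A \<times> A. (\<eta> (b, c), a) \<in> prod_order r r \<longrightarrow>
          lo b \<le> f a \<and> f a \<le> up c)"
      unfolding o3_conv_def by blast
    \<comment> \<open>In the third mode the auxiliary nets stay as they are; only the threshold
      \<open>\<eta> (b, c)\<close>, a pair, is replaced by an index \<open>h (\<eta> (b, c))\<close>
      whose diagonal tail lies beyond it.\<close>
    obtain h where h: "h p \<in> A \<and> (\<forall>a\<in>A. (h p, a) \<in> r \<longrightarrow> (p, (a, a)) \<in> prod_order r r)"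
      if "p \<in> A \<times> A" for p using upper by metis
    have "o3_conv A r (\<lambda>a. f (a, a)) l"
      by (rule o3_convI[OF *(1-4), of "h \<circ> \<eta>"]) (use *(5) h in \<open>fastforce\<close>)
    then show ?thesis using 3 by (simp add: order_conv_def)
  qed
qed

section \<open>Comparison of the three modes of convergence\<close>

lemma o2_conv_imp_o3_conv:
  assumes A: "index_poset A r" and "o2_conv A r x l"
  shows "o3_conv A r x l"
proof -
  obtain lo up a0 where *: "net_up A r lo l" "net_down A r up l" "a0 \<in> A"
    "\<forall>a\<in>A. (a0, a) \<in> r \<longrightarrow> lo a \<le> x a \<and> x a \<le> up a"
    using assms(2) unfolding o2_conv_def by blast
  \<comment> \<open>Both bounding nets keep the index set \<open>A\<close>. The threshold for
    \<open>(b, c)\<close> lies beyond \<open>a0\<close>, so that the sandwich holds, and beyond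
    \<open>b\<close> and \<open>c\<close>, so that monotonicity replaces \<open>lo a\<close> by
    \<open>lo b\<close> and \<open>up a\<close> by \<open>up c\<close>.\<close>
  have "\<exists>d\<in>A. (a0, d) \<in> r \<and> (b, d) \<in> r \<and> (c, d) \<in> r" if "b \<in> A" "c \<in> A" for b c
    using that *(3) index_poset_upper[OF A] index_poset_trans[OF A] by metis
  then obtain h where h: "h b c \<in> A \<and> (a0, h b c) \<in> r \<and> (b, h b c) \<in> r \<and> (c, h b c) \<in> r"
    if "b \<in> A" "c \<in> A" for b c by metis
  show ?thesis
  proof (rule o3_convI[OF A A *(1,2), of "\<lambda>(b, c). h b c"], intro ballI conjI impI)
    fix b c a assume bc: "b \<in> A" "c \<in> A" and a: "a \<in> A" "((case (b, c) of (b, c) \<Rightarrow> h b c), a) \<in> r"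
    then have r: "(a0, a) \<in> r" "(b, a) \<in> r" "(c, a) \<in> r"
      using h[OF bc] index_poset_trans[OF A] by auto
    show "lo b \<le> x a" using *(1,4) r bc a unfolding net_up_iff by (meson order_trans)
    show "x a \<le> up c" using *(2,4) r bc a unfolding net_down_iff by (meson order_trans)
  qed (use h in auto)
qed

lemma o1_conv_imp_o2_conv:
  assumes "index_poset A r" "o1_conv A r x l"
  shows "o2_conv A r x l"
  using assms index_poset_nonempty[OF assms(1)] unfolding o1_conv_def o2_conv_def by blast

text \<open>The first mode is the strongest and the third the weakest. The converse direction can
  thus treat all \<open>i\<close> at once: test nets are supplied in the first mode and conclusions
  are read off in the third.\<close>

lemma o1_conv_imp_order_conv:
  assumes "index_poset A r" "o1_conv A r x l" "i \<in> {1, 2, 3}"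
  shows "order_conv i A r x l"
  using assms o1_conv_imp_o2_conv o2_conv_imp_o3_conv unfolding order_conv_def by blast

lemma order_conv_imp_o3_conv:
  assumes "index_poset A r" "order_conv i A r x l"
  shows "o3_conv A r x l"
  using assms o1_conv_imp_o2_conv o2_conv_imp_o3_conv unfolding order_conv_def by blast

lemma o1_conv_const: "index_poset A r \<Longrightarrow> o1_conv A r (\<lambda>_. l) l"
  unfolding o1_conv_def net_up_iff net_down_iff using index_poset_nonempty
  by (intro exI[of _ "\<lambda>_. l"]) auto

section \<open>Symmetric bounds given by a single net decreasing to zero\<close>

lemma net_down_diff:
  fixes lo :: "'b \<Rightarrow> 'a::ordered_real_vector"
  assumes lo: "net_up B s lo l" and up: "net_down C t up l"
  shows "net_down (B \<times> C) (prod_order s t) (\<lambda>(b, c). up c - lo b) 0"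
proof -
  have "g \<le> 0" if g: "\<forall>b\<in>B. \<forall>c\<in>C. g \<le> up c - lo b" for g
  proof -
    \<comment> \<open>The two limits are used one after the other: for fixed \<open>b\<close> the
      infimum over \<open>C\<close> gives \<open>g + lo b \<le> l\<close>; then \<open>l - g\<close>
      is an upper bound of all \<open>lo b\<close>, hence at least their supremum
      \<open>l\<close>.\<close>
    have "g + lo b \<le> l" if "b \<in> B" for b
      using up g that unfolding net_down_iff by (metis le_diff_eq)
    then have "\<forall>b\<in>B. lo b \<le> l - g" by (simp add: le_diff_eq add.commute)
    then have "l \<le> l - g" using lo unfolding net_up_iff by blast
    then show ?thesis by simp
  qed
  moreover have "lo b \<le> up c" if "b \<in> B" "c \<in> C" for b c
    using lo up that unfolding net_up_iff net_down_iff by (meson order_trans)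
  moreover have "up c - lo b \<le> up c' - lo b'"
    if "b \<in> B" "c \<in> C" "b' \<in> B" "c' \<in> C" "(b', b) \<in> s" "(c', c) \<in> t" for b c b' c'
    using lo up that unfolding net_up_iff net_down_iff by (meson diff_mono)
  ultimately show ?thesis unfolding net_down_iff prod_order_def by auto
qed

lemma net_shift:
  fixes w :: "'b \<Rightarrow> 'a::ordered_real_vector"
  assumes "net_down A r w 0"
  shows net_up_minus_shift: "net_up A r (\<lambda>a. l - w a) l"
    and net_down_plus_shift: "net_down A r (\<lambda>a. l + w a) l"
proof -
  have "l \<le> g" if "\<forall>a\<in>A. l - w a \<le> g" for g
  proof -
    have "\<forall>a\<in>A. l - g \<le> w a" using that by (simp add: algebra_simps)
    then show ?thesis using assms unfolding net_down_iff by (metis diff_le_0_iff_le)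
  qed
  then show "net_up A r (\<lambda>a. l - w a) l" using assms unfolding net_down_iff net_up_iff by auto
  have "g \<le> l" if "\<forall>a\<in>A. g \<le> l + w a" for g
  proof -
    have "\<forall>a\<in>A. g - l \<le> w a" using that by (simp add: algebra_simps)
    then show ?thesis using assms unfolding net_down_iff by (metis diff_le_0_iff_le)
  qed
  then show "net_down A r (\<lambda>a. l + w a) l" using assms unfolding net_down_iff by auto
qed

text \<open>Both \<open>l\<close> and \<open>x\<close> lie in the order interval from
  \<open>lo\<close> to \<open>up\<close>, so they differ by at most its width.\<close>

lemma sandwich_diff:
  fixes lo :: "'a::ordered_real_vector"
  assumes "lo \<le> l" "l \<le> up" "lo \<le> x" "x \<le> up"
  shows "l - (up - lo) \<le> x \<and> x \<le> l + (up - lo)"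
proof
  have "l + lo \<le> up + x" "lo + x \<le> l + up" using assms by (auto intro: add_mono)
  then show "l - (up - lo) \<le> x" "x \<le> l + (up - lo)" by (simp_all add: algebra_simps)
qed

text \<open>The first two modes require the bound to be indexed by \<open>A\<close> itself, so the
  widths over \<open>A \<times> A\<close> are restricted to the diagonal.\<close>

lemma net_sandwich:
  fixes lo :: "'b \<Rightarrow> 'a::ordered_real_vector"
  assumes A: "index_poset A r" and lo: "net_up A r lo l" and up: "net_down A r up l"
  shows "net_down A r (\<lambda>a. up a - lo a) 0"
    and "a \<in> A \<Longrightarrow> lo a \<le> x \<Longrightarrow> x \<le> up a \<Longrightarrow> l - (up a - lo a) \<le> x \<and> x \<le> l + (up a - lo a)"
  using net_down_diag[OF A net_down_diff[OF lo up]] lo up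
  by (auto simp: net_up_iff net_down_iff intro!: sandwich_diff[THEN conjunct1]
      sandwich_diff[THEN conjunct2])

lemma o1_conv_iff:
  fixes x :: "'i \<Rightarrow> 'a::ordered_real_vector"
  assumes A: "index_poset A r"
  shows "o1_conv A r x l \<longleftrightarrow>
    (\<exists>w. net_down A r w 0 \<and> (\<forall>a\<in>A. l - w a \<le> x a \<and> x a \<le> l + w a))"
proof
  assume "o1_conv A r x l"
  then obtain lo up where *: "net_up A r lo l" "net_down A r up l"
    "\<forall>a\<in>A. lo a \<le> x a \<and> x a \<le> up a" unfolding o1_conv_def by blast
  then show "\<exists>w. net_down A r w 0 \<and> (\<forall>a\<in>A. l - w a \<le> x a \<and> x a \<le> l + w a)"
    using net_sandwich[OF A *(1,2)] by (intro exI[of _ "\<lambda>a. up a - lo a"]) blast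
next
  assume "\<exists>w. net_down A r w 0 \<and> (\<forall>a\<in>A. l - w a \<le> x a \<and> x a \<le> l + w a)"
  then obtain w where w: "net_down A r w 0"
    and le: "\<forall>a\<in>A. l - w a \<le> x a \<and> x a \<le> l + w a" by blast
  show "o1_conv A r x l" unfolding o1_conv_def using net_shift[OF w, of l] le by blast
qed

lemma o2_conv_iff:
  fixes x :: "'i \<Rightarrow> 'a::ordered_real_vector"
  assumes A: "index_poset A r"
  shows "o2_conv A r x l \<longleftrightarrow> (\<exists>w. net_down A r w 0 \<and>
    (\<exists>a0\<in>A. \<forall>a\<in>A. (a0, a) \<in> r \<longrightarrow> l - w a \<le> x a \<and> x a \<le> l + w a))"
proof
  assume "o2_conv A r x l"
  then obtain lo up a0 where *: "net_up A r lo l" "net_down A r up l" "a0 \<in> A"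
    "\<forall>a\<in>A. (a0, a) \<in> r \<longrightarrow> lo a \<le> x a \<and> x a \<le> up a" unfolding o2_conv_def by blast
  then show "\<exists>w. net_down A r w 0 \<and>
    (\<exists>a0\<in>A. \<forall>a\<in>A. (a0, a) \<in> r \<longrightarrow> l - w a \<le> x a \<and> x a \<le> l + w a)"
    using net_sandwich[OF A *(1,2)] by (intro exI[of _ "\<lambda>a. up a - lo a"]) blast
next
  assume "\<exists>w. net_down A r w 0 \<and>
    (\<exists>a0\<in>A. \<forall>a\<in>A. (a0, a) \<in> r \<longrightarrow> l - w a \<le> x a \<and> x a \<le> l + w a)"
  then obtain w where w: "net_down A r w 0"
    and ex: "\<exists>a0\<in>A. \<forall>a\<in>A. (a0, a) \<in> r \<longrightarrow> l - w a \<le> x a \<and> x a \<le> l + w a" by blast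
  show "o2_conv A r x l" unfolding o2_conv_def using net_shift[OF w, of l] ex by blast
qed

text \<open>In the third mode the two bounds have independent indices. The width
  \<open>up c - lo b\<close> is a net over \<open>B \<times> C\<close>, where \<open>\<eta>\<close>
  already lives; this explains the index type \<open>'a \<times> 'a\<close>.\<close>

lemma o3_convE:
  fixes x :: "'i \<Rightarrow> 'a::ordered_real_vector"
  assumes "o3_conv A r x l"
  obtains D :: "('a \<times> 'a) set" and s w \<eta> where "index_poset D s" "net_down D s w 0"
    "\<And>d. d \<in> D \<Longrightarrow> \<eta> d \<in> A"
    "\<And>d a. d \<in> D \<Longrightarrow> a \<in> A \<Longrightarrow> (\<eta> d, a) \<in> r \<Longrightarrow> l - w d \<le> x a \<and> x a \<le> l + w d"
proof -
  obtain B :: "'a set" and s and C :: "'a set" and t lo up \<eta> where *: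
    "index_poset B s" "index_poset C t" "net_up B s lo l" "net_down C t up l"
    "\<forall>b\<in>B. \<forall>c\<in>C. \<eta> (b, c) \<in> A \<and>
       (\<forall>a\<in>A. (\<eta> (b, c), a) \<in> r \<longrightarrow> lo b \<le> x a \<and> x a \<le> up c)"
    using assms unfolding o3_conv_def by blast
  show ?thesis
  proof (rule that[OF index_poset_prod[OF *(1,2)] net_down_diff[OF *(3,4)], of \<eta>])
    fix d a assume d: "d \<in> B \<times> C" and a: "a \<in> A" "(\<eta> d, a) \<in> r"
    obtain b c where d_eq: "d = (b, c)" by (cases d)
    with d a *(5) have "lo b \<le> x a" "x a \<le> up c" by auto
    moreover have "lo b \<le> l" "l \<le> up c" using *(3,4) d d_eq by (auto simp: net_up_iff net_down_iff)
    ultimately show "l - (case d of (b, c) \<Rightarrow> up c - lo b) \<le> x a \<and>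
        x a \<le> l + (case d of (b, c) \<Rightarrow> up c - lo b)"
      unfolding d_eq prod.case by (intro sandwich_diff)
  qed (use *(5) in auto)
qed

lemma o3_conv_sandwichI:
  fixes x :: "'i \<Rightarrow> 'a::ordered_real_vector"
  assumes A: "index_poset A r" and D: "index_poset D s" and w: "net_down D s w 0"
    and \<eta>: "\<And>d. d \<in> D \<Longrightarrow> \<eta> d \<in> A"
    and le: "\<And>d a. d \<in> D \<Longrightarrow> a \<in> A \<Longrightarrow> (\<eta> d, a) \<in> r \<Longrightarrow> l - w d \<le> x a \<and> x a \<le> l + w d"
  shows "o3_conv A r x l"
proof -
  \<comment> \<open>The third mode wants a threshold for each pair of a lower index \<open>d\<close>
    and an upper index \<open>e\<close>; an index above both \<open>\<eta> d\<close> and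
    \<open>\<eta> e\<close> serves.\<close>
  have "\<exists>c\<in>A. (\<eta> d, c) \<in> r \<and> (\<eta> e, c) \<in> r" if "d \<in> D" "e \<in> D" for d e
    using that index_poset_upper[OF A] \<eta> by blast
  then obtain h where h: "h d e \<in> A \<and> (\<eta> d, h d e) \<in> r \<and> (\<eta> e, h d e) \<in> r"
    if "d \<in> D" "e \<in> D" for d e by metis
  show ?thesis
  proof (rule o3_convI[OF D D net_shift[OF w], of "\<lambda>(d, e). h d e"], intro ballI conjI impI)
    fix d e a assume de: "d \<in> D" "e \<in> D"
      and a: "a \<in> A" "((case (d, e) of (d, e) \<Rightarrow> h d e), a) \<in> r"
    then have "(\<eta> d, a) \<in> r" "(\<eta> e, a) \<in> r" using h[OF de] index_poset_trans[OF A] by auto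
    then show "l - w d \<le> x a" "x a \<le> l + w e" using le de a by auto
  qed (use h in auto)
qed

section \<open>Scalar multiplication under the Archimedean and directedness hypotheses\<close>

lemma archimedean_le_0:
  fixes g f :: "'a::ordered_real_vector"
  assumes arch: "archimedean_pov TYPE('a)" and m: "net_down A r m (0::real)"
    and f: "0 \<le> f" and le: "\<And>a. a \<in> A \<Longrightarrow> g \<le> m a *\<^sub>R f"
  shows "g \<le> 0"
proof -
  have "real n *\<^sub>R g \<le> f" for n
  proof (cases "n = 0")
    case False
    \<comment> \<open>Since the infimum of \<open>m\<close> is 0, the positive number
      \<open>1 / n\<close> is no lower bound, and the order of the reals is total: some
      \<open>m a\<close> is at most \<open>1 / n\<close>.\<close>
    have "\<not> (\<forall>a\<in>A. 1 / real n \<le> m a)"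
      using m False unfolding net_down_iff by (metis divide_pos_pos not_le of_nat_0_less_iff
          neq0_conv zero_less_one)
    then obtain a where a: "a \<in> A" "m a \<le> 1 / real n" by (auto simp: not_le intro: less_imp_le)
    then have "g \<le> (1 / real n) *\<^sub>R f" using le[OF a(1)] scaleR_right_mono[OF a(2) f] by simp
    then have "real n *\<^sub>R g \<le> real n *\<^sub>R ((1 / real n) *\<^sub>R f)" by (intro scaleR_left_mono) auto
    then show ?thesis using False by simp
  qed (use f in simp)
  then show ?thesis using arch unfolding archimedean_pov_def by blast
qed

text \<open>The infimum is taken in two stages, first over \<open>a\<close> with \<open>b\<close>
  fixed, then over \<open>b\<close>. In the application \<open>c\<close> is the absolute value of
  the scalar limit.\<close>

lemma net_down_product_bound:
  fixes u :: "'j \<Rightarrow> 'a::ordered_real_vector"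
  assumes arch: "archimedean_pov TYPE('a)" and m: "net_down A r m (0::real)"
    and u: "net_down B s u 0" and c: "0 \<le> c" and e: "0 \<le> e"
  shows "net_down (A \<times> B) (prod_order r s) (\<lambda>(a, b). m a *\<^sub>R u b + c *\<^sub>R u b + m a *\<^sub>R e) 0"
proof -
  have m0: "0 \<le> m a" if "a \<in> A" for a using m that unfolding net_down_iff by blast
  have u0: "0 \<le> u b" if "b \<in> B" for b using u that unfolding net_down_iff by blast
  have "g \<le> 0" if g: "\<And>a b. a \<in> A \<Longrightarrow> b \<in> B \<Longrightarrow> g \<le> m a *\<^sub>R u b + c *\<^sub>R u b + m a *\<^sub>R e" for g
  proof -
    have gc: "g \<le> c *\<^sub>R u b" if b: "b \<in> B" for b
    proof -
      \<comment> \<open>Both terms containing \<open>m a\<close> are gathered into a multiple of the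
        fixed positive vector \<open>u b + e\<close>, to which the Archimedean estimate
        applies.\<close>
      have "g - c *\<^sub>R u b \<le> m a *\<^sub>R (u b + e)" if "a \<in> A" for a
        using g[OF that b] by (simp add: algebra_simps)
      then have "g - c *\<^sub>R u b \<le> 0"
        using archimedean_le_0[OF arch m add_nonneg_nonneg[OF u0[OF b] e]] by blast
      then show ?thesis by simp
    qed
    show ?thesis
    \<comment> \<open>For \<open>c = 0\<close> the bound is already \<open>g \<le> 0\<close>;
      otherwise division by \<open>c\<close> makes \<open>inverse c *\<^sub>R g\<close> a lower
      bound of \<open>u\<close>.\<close>
    proof (cases "c = 0")
      case True
      then have "\<forall>b\<in>B. g \<le> u b" using gc True u0 by (fastforce intro: order_trans)
      then show ?thesis using u unfolding net_down_iff by blast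
    next
      case False
      then have "inverse c *\<^sub>R g \<le> u b" if "b \<in> B" for b
        using scaleR_left_mono[OF gc[OF that], of "inverse c"] c by simp
      then have "inverse c *\<^sub>R g \<le> 0" using u unfolding net_down_iff by blast
      then show ?thesis using scaleR_left_mono[of "inverse c *\<^sub>R g" 0 c] c False by simp
    qed
  qed
  moreover have "m a *\<^sub>R u b + c *\<^sub>R u b + m a *\<^sub>R e \<le> m a' *\<^sub>R u b' + c *\<^sub>R u b' + m a' *\<^sub>R e"
    if "a \<in> A" "b \<in> B" "a' \<in> A" "b' \<in> B" "(a', a) \<in> r" "(b', b) \<in> s" for a b a' b'
  proof -
    have "m a \<le> m a'" "u b \<le> u b'" using m u that unfolding net_down_iff by blast+
    then show ?thesis using m0 u0 c e that
      by (intro add_mono scaleR_mono scaleR_left_mono scaleR_right_mono) auto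
  qed
  moreover have "0 \<le> m a *\<^sub>R u b + c *\<^sub>R u b + m a *\<^sub>R e" if "a \<in> A" "b \<in> B" for a b
    using m0 u0 c e that by (intro add_nonneg_nonneg scaleR_nonneg_nonneg) auto
  ultimately show ?thesis unfolding net_down_iff prod_order_def by auto
qed

text \<open>\<open>X\<close> need not be a lattice, so the modulus of \<open>v\<close> is replaced
  by the two-sided bound \<open>u\<close>, and the sign of \<open>t\<close> decides which side is
  used.\<close>

lemma scaleR_bound:
  fixes v :: "'a::ordered_real_vector"
  assumes t: "\<bar>t\<bar> \<le> m" and v: "- u \<le> v" "v \<le> u"
  shows "t *\<^sub>R v \<le> m *\<^sub>R u"
proof -
  have "- u \<le> u" using v by (rule order_trans)
  then have "0 \<le> 2 *\<^sub>R u" using add_left_mono[of "- u" u u] by (simp add: scaleR_2)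
  then have "0 \<le> u" using scaleR_left_mono[of 0 "2 *\<^sub>R u" "1/2"] by simp
  then have *: "\<bar>t\<bar> *\<^sub>R u \<le> m *\<^sub>R u" using t by (intro scaleR_right_mono)
  show ?thesis
  proof (cases "0 \<le> t")
    case True
    then show ?thesis using * scaleR_left_mono[OF v(2) True] by simp
  next
    case False
    then have "t *\<^sub>R v \<le> t *\<^sub>R (- u)" using v(1) by (intro scaleR_left_mono_neg) auto
    then show ?thesis using * False by simp
  qed
qed

text \<open>Expand \<open>t v - l y = (t - l)(v - y) + l (v - y) + (t - l) y\<close> and bound each
  summand by \<open>scaleR_bound\<close>. Negating the scalar factors gives the lower
  estimate.\<close>

lemma scaleR_sandwich:
  fixes v y :: "'a::ordered_real_vector"
  assumes t: "l - m \<le> t \<and> t \<le> l + m" and v: "y - u \<le> v \<and> v \<le> y + u"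
    and e: "- e \<le> y" "y \<le> e"
  shows "l *\<^sub>R y - (m *\<^sub>R u + \<bar>l\<bar> *\<^sub>R u + m *\<^sub>R e) \<le> t *\<^sub>R v \<and>
         t *\<^sub>R v \<le> l *\<^sub>R y + (m *\<^sub>R u + \<bar>l\<bar> *\<^sub>R u + m *\<^sub>R e)"
proof -
  have tl: "\<bar>t - l\<bar> \<le> m" "\<bar>-(t - l)\<bar> \<le> m" using t by auto
  have vu: "- u \<le> v - y" "v - y \<le> u" using v by (auto simp: algebra_simps)
  have "(t - l) *\<^sub>R (v - y) + l *\<^sub>R (v - y) + (t - l) *\<^sub>R y \<le> m *\<^sub>R u + \<bar>l\<bar> *\<^sub>R u + m *\<^sub>R e"
    using tl vu e by (intro add_mono scaleR_bound) auto
  moreover have "(-(t - l)) *\<^sub>R (v - y) + (-l) *\<^sub>R (v - y) + (-(t - l)) *\<^sub>R y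
      \<le> m *\<^sub>R u + \<bar>l\<bar> *\<^sub>R u + m *\<^sub>R e"
    using tl vu e by (intro add_mono scaleR_bound) auto
  ultimately show ?thesis by (simp add: algebra_simps)
qed

lemma directed_pov_bound:
  fixes y :: "'a::ordered_real_vector"
  assumes "directed_pov TYPE('a)"
  obtains e where "0 \<le> e" "- e \<le> y" "y \<le> e"
proof -
  obtain e1 where e1: "0 \<le> e1" "y \<le> e1" using assms unfolding directed_pov_def by blast
  obtain e2 where e2: "e1 \<le> e2" "- y \<le> e2" using assms unfolding directed_pov_def by blast
  show ?thesis using that[of e2] e1 e2 by (auto simp: minus_le_iff intro: order_trans)
qed

lemma order_conv_scaleR:
  fixes x :: "'j \<Rightarrow> 'a::ordered_real_vector" and \<mu> :: "'i \<Rightarrow> real"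
  assumes arch: "archimedean_pov TYPE('a)" and dir: "directed_pov TYPE('a)"
    and A: "index_poset A r" and B: "index_poset B s"
    and \<mu>: "order_conv i A r \<mu> l" and x: "order_conv i B s x y"
  shows "order_conv i (A \<times> B) (prod_order r s) (\<lambda>(a, b). \<mu> a *\<^sub>R x b) (l *\<^sub>R y)"
proof -
  obtain e where e: "0 \<le> e" "- e \<le> y" "y \<le> e" using directed_pov_bound[OF dir] .
  note AB = index_poset_prod[OF A B]
  consider (1) "i = 1" "o1_conv A r \<mu> l" "o1_conv B s x y"
    | (2) "i = 2" "o2_conv A r \<mu> l" "o2_conv B s x y"
    | (3) "i = 3" "o3_conv A r \<mu> l" "o3_conv B s x y"
    using \<mu> x unfolding order_conv_def by auto
  then show ?thesis
  proof cases
    case 1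
    from 1 obtain m u where mu: "net_down A r m 0" "\<forall>a\<in>A. l - m a \<le> \<mu> a \<and> \<mu> a \<le> l + m a"
      "net_down B s u 0" "\<forall>b\<in>B. y - u b \<le> x b \<and> x b \<le> y + u b"
      unfolding o1_conv_iff[OF A] o1_conv_iff[OF B] by blast
    have "o1_conv (A \<times> B) (prod_order r s) (\<lambda>(a, b). \<mu> a *\<^sub>R x b) (l *\<^sub>R y)"
      unfolding o1_conv_iff[OF AB]
    proof (intro exI conjI)
      show "net_down (A \<times> B) (prod_order r s)
          (\<lambda>(a, b). m a *\<^sub>R u b + \<bar>l\<bar> *\<^sub>R u b + m a *\<^sub>R e) 0"
        using net_down_product_bound[OF arch mu(1,3) _ e(1)] by simp
    qed (use mu(2,4) e in \<open>auto intro!: scaleR_sandwich[THEN conjunct1] scaleR_sandwich[THEN conjunct2]\<close>)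
    then show ?thesis using 1 by (simp add: order_conv_def)
  next
    case 2
    from 2 obtain m u a0 b0 where mu: "net_down A r m 0" "a0 \<in> A"
      "\<forall>a\<in>A. (a0, a) \<in> r \<longrightarrow> l - m a \<le> \<mu> a \<and> \<mu> a \<le> l + m a"
      "net_down B s u 0" "b0 \<in> B"
      "\<forall>b\<in>B. (b0, b) \<in> s \<longrightarrow> y - u b \<le> x b \<and> x b \<le> y + u b"
      unfolding o2_conv_iff[OF A] o2_conv_iff[OF B] by blast
    have "o2_conv (A \<times> B) (prod_order r s) (\<lambda>(a, b). \<mu> a *\<^sub>R x b) (l *\<^sub>R y)"
      unfolding o2_conv_iff[OF AB]
    proof (intro exI conjI bexI)
      show "net_down (A \<times> B) (prod_order r s)
          (\<lambda>(a, b). m a *\<^sub>R u b + \<bar>l\<bar> *\<^sub>R u b + m a *\<^sub>R e) 0"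
        using net_down_product_bound[OF arch mu(1,4) _ e(1)] by simp
      show "(a0, b0) \<in> A \<times> B" using mu by simp
    qed (use mu(3,6) e in \<open>auto simp: prod_order_def
      intro!: scaleR_sandwich[THEN conjunct1] scaleR_sandwich[THEN conjunct2]\<close>)
    then show ?thesis using 2 by (simp add: order_conv_def)
  next
    case 3
    obtain D :: "(real \<times> real) set" and p m \<eta> where
      D: "index_poset D p" "net_down D p m 0" "\<And>d. d \<in> D \<Longrightarrow> \<eta> d \<in> A"
      "\<And>d a. d \<in> D \<Longrightarrow> a \<in> A \<Longrightarrow> (\<eta> d, a) \<in> r \<Longrightarrow> l - m d \<le> \<mu> a \<and> \<mu> a \<le> l + m d"
      by (rule o3_convE[OF 3(2)]) blast
    obtain E :: "('a \<times> 'a) set" and q u \<theta> where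
      E: "index_poset E q" "net_down E q u 0" "\<And>d. d \<in> E \<Longrightarrow> \<theta> d \<in> B"
      "\<And>d b. d \<in> E \<Longrightarrow> b \<in> B \<Longrightarrow> (\<theta> d, b) \<in> s \<Longrightarrow> y - u d \<le> x b \<and> x b \<le> y + u d"
      by (rule o3_convE[OF 3(3)]) blast
    \<comment> \<open>The bound is now indexed by the auxiliary set \<open>D \<times> E\<close>; the
      thresholds are combined componentwise by \<open>map_prod \<eta> \<theta>\<close>.\<close>
    have "net_down (D \<times> E) (prod_order p q)
        (\<lambda>(a, b). m a *\<^sub>R u b + \<bar>l\<bar> *\<^sub>R u b + m a *\<^sub>R e) 0"
      using net_down_product_bound[OF arch D(2) E(2) _ e(1)] by simp
    then have "o3_conv (A \<times> B) (prod_order r s) (\<lambda>(a, b). \<mu> a *\<^sub>R x b) (l *\<^sub>R y)"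
    proof (rule o3_conv_sandwichI[OF AB index_poset_prod[OF D(1) E(1)], where \<eta> = "map_prod \<eta> \<theta>"])
      show "map_prod \<eta> \<theta> d \<in> A \<times> B" if "d \<in> D \<times> E" for d using that D(3) E(3) by auto
    qed (use D(4) E(4) e in \<open>auto simp: prod_order_def
      intro!: scaleR_sandwich[THEN conjunct1] scaleR_sandwich[THEN conjunct2]\<close>)
    then show ?thesis using 3 by (simp add: order_conv_def)
  qed
qed

section \<open>From convergence of scaled vectors back to the order properties\<close>

lemma archimedean_directed_if_scaleR_conv:
  fixes A :: "'i set" and \<mu> :: "'i \<Rightarrow> real"
  assumes A: "index_poset A r" and pos: "\<And>a. a \<in> A \<Longrightarrow> 0 < \<mu> a"
    and conv: "\<And>x :: 'a::ordered_real_vector. o3_conv A r (\<lambda>a. \<mu> a *\<^sub>R x) 0"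
  shows "archimedean_pov TYPE('a) \<and> directed_pov TYPE('a)"
proof -
  \<comment> \<open>Fixing one \<open>b\<close> makes the threshold depend on \<open>c\<close>
    alone; by reflexivity the index \<open>\<eta> (b, c)\<close> itself satisfies the upper
    estimate.\<close>
  have upper: "\<exists>(C :: 'a set) t up. index_poset C t \<and> net_down C t up (0::'a) \<and>
      (\<forall>c\<in>C. \<exists>a\<in>A. \<mu> a *\<^sub>R x \<le> up c)" for x :: 'a
  proof -
    obtain B s C t lo up \<eta> where *: "index_poset (B :: 'a set) s" "index_poset (C :: 'a set) t"
      "net_down C t up (0::'a)" "\<forall>b\<in>B. \<forall>c\<in>C. \<eta> (b, c) \<in> A \<and>
        (\<forall>a\<in>A. (\<eta> (b, c), a) \<in> r \<longrightarrow> lo b \<le> \<mu> a *\<^sub>R x \<and> \<mu> a *\<^sub>R x \<le> up c)"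
      using conv[of x] unfolding o3_conv_def by blast
    obtain b where "b \<in> B" using index_poset_nonempty[OF *(1)] by blast
    then have "\<forall>c\<in>C. \<exists>a\<in>A. \<mu> a *\<^sub>R x \<le> up c" using *(4) index_poset_refl[OF A] by blast
    then show ?thesis using *(2,3) by blast
  qed
  \<comment> \<open>Dividing \<open>up c\<close> by \<open>\<mu> a\<close> gives a positive upper
    bound of \<open>x - y\<close>; adding \<open>y\<close> gives a common upper bound of
    \<open>x\<close> and \<open>y\<close>.\<close>
  have "\<exists>z. x \<le> z \<and> y \<le> z" for x y :: 'a
  proof -
    obtain C :: "'a set" and t up where C: "index_poset C t" "net_down C t up 0"
      "\<forall>c\<in>C. \<exists>a\<in>A. \<mu> a *\<^sub>R (x - y) \<le> up c" using upper by blast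
    then obtain c a where c: "c \<in> C" "a \<in> A" "\<mu> a *\<^sub>R (x - y) \<le> up c"
      using index_poset_nonempty by (metis ex_in_conv)
    have "0 \<le> up c" using C(2) c(1) unfolding net_down_iff by blast
    then have "0 \<le> inverse (\<mu> a) *\<^sub>R up c" using pos[OF c(2)]
      by (intro scaleR_nonneg_nonneg) (auto intro: less_imp_le)
    moreover have "x - y \<le> inverse (\<mu> a) *\<^sub>R up c"
      using scaleR_left_mono[OF c(3), of "inverse (\<mu> a)"] pos[OF c(2)] by simp
    ultimately show ?thesis
      by (intro exI[of _ "inverse (\<mu> a) *\<^sub>R up c + y"]) (simp add: diff_le_eq)
  qed
  moreover have "x \<le> 0" if le: "\<And>n::nat. real n *\<^sub>R x \<le> y" for x y :: 'a
  proof -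
    have y: "0 \<le> y" using le[of 0] by simp
    \<comment> \<open>Choose \<open>n\<close> with \<open>1 / n < \<mu> a\<close>; then
      \<open>x \<le> y / n\<close>, and \<open>0 \<le> y\<close>, which is the case
      \<open>n = 0\<close> of the assumption, allows enlarging the scalar.\<close>
    have x_le: "x \<le> \<mu> a *\<^sub>R y" if a: "a \<in> A" for a
    proof -
      obtain n where n: "0 < n" "inverse (real n) < \<mu> a"
        using ex_inverse_of_nat_less[OF pos[OF a]] by blast
      have "x \<le> inverse (real n) *\<^sub>R y"
        using scaleR_left_mono[OF le[of n], of "inverse (real n)"] n by simp
      also have "\<dots> \<le> \<mu> a *\<^sub>R y" using n y by (intro scaleR_right_mono) auto
      finally show ?thesis .
    qed
    obtain C :: "'a set" and t up where C: "net_down C t up 0"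
      "\<forall>c\<in>C. \<exists>a\<in>A. \<mu> a *\<^sub>R y \<le> up c" using upper by blast
    then have "\<forall>c\<in>C. x \<le> up c" using x_le by (meson order_trans)
    then show ?thesis using C(1) unfolding net_down_iff by blast
  qed
  ultimately show ?thesis unfolding archimedean_pov_def directed_pov_def by blast
qed

text \<open>The sequence \<open>1 / (n + 1)\<close> is transported along an injection of the
  naturals into \<open>'i\<close>. On a finite type no such net exists: a finite directed set has a
  greatest element, and there a net with this limit is zero.\<close>

lemma ex_positive_null_net:
  assumes "infinite (UNIV :: 'i set)"
  obtains A :: "'i set" and r and \<mu> :: "'i \<Rightarrow> real"
  where "index_poset A r" "\<And>a. a \<in> A \<Longrightarrow> 0 < \<mu> a" "o1_conv A r \<mu> 0"
proof -
  obtain f :: "nat \<Rightarrow> 'i" where f: "inj f" using infinite_countable_subset[OF assms] by blast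
  define r where "r = {(f m, f n) | m n. m \<le> n}"
  define \<mu> where "\<mu> = (\<lambda>a. inverse (real (Suc (inv f a))))"
  have \<mu>: "\<mu> (f n) = inverse (real (Suc n))" for n using f by (simp add: \<mu>_def)
  have r: "(f m, f n) \<in> r \<longleftrightarrow> m \<le> n" for m n using f by (auto simp: r_def dest: injD)
  have "partial_order_on (range f) r"
    unfolding order_on_defs refl_on_def trans_def antisym_def
    by (auto simp: r_def inj_eq[OF f])
  moreover have "\<exists>c\<in>range f. (a, c) \<in> r \<and> (b, c) \<in> r" if ab: "a \<in> range f" "b \<in> range f" for a b
  proof -
    obtain m n where "a = f m" "b = f n" using ab by blast
    then show ?thesis by (intro bexI[of _ "f (max m n)"]) (auto simp: r)
  qed
  ultimately have A: "index_poset (range f) r" unfolding index_poset_def by blast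
  have "g \<le> 0" if "\<forall>n. g \<le> inverse (real (Suc n))" for g
    using that by (meson not_le reals_Archimedean)
  then have "net_down (range f) r \<mu> 0"
    unfolding net_down_iff by (auto simp: \<mu> r intro!: le_imp_inverse_le)
  then have "o1_conv (range f) r \<mu> 0"
    unfolding o1_conv_iff[OF A] by (intro exI[of _ \<mu>]) (auto simp: \<mu>)
  moreover have "0 < \<mu> a" for a by (simp add: \<mu>_def)
  ultimately show ?thesis using that[OF A] by blast
qed

section \<open>Assembling the equivalences\<close>

lemma index_poset_singleton: "index_poset {a} {(a, a)}"
  by (auto simp: index_poset_def order_on_defs refl_on_def trans_def antisym_def)

theorem proposition8p2:
  fixes i :: nat
  assumes "i \<in> {1, 2, 3}"
    and "infinite (UNIV :: 'i set)"
  shows "((archimedean_pov TYPE('a::ordered_real_vector) \<and> directed_pov TYPE('a)) \<longleftrightarrow>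
      (\<forall>(A :: 'i set) r (B :: 'j set) s (\<mu> :: 'i \<Rightarrow> real) l (x :: 'j \<Rightarrow> 'a) y.
         index_poset A r \<and> index_poset B s \<and> order_conv i A r \<mu> l \<and> order_conv i B s x y \<longrightarrow>
         order_conv i (A \<times> B) (prod_order r s) (\<lambda>(a, b). \<mu> a *\<^sub>R x b) (l *\<^sub>R y)))
    \<and> ((archimedean_pov TYPE('a) \<and> directed_pov TYPE('a)) \<longleftrightarrow>
      (\<forall>(A :: 'i set) r (\<mu> :: 'i \<Rightarrow> real) l (x :: 'i \<Rightarrow> 'a) y.
         index_poset A r \<and> order_conv i A r \<mu> l \<and> order_conv i A r x y \<longrightarrow>
         order_conv i A r (\<lambda>a. \<mu> a *\<^sub>R x a) (l *\<^sub>R y)))"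
  (is "(?i \<longleftrightarrow> ?ii) \<and> (?i \<longleftrightarrow> ?iii)")
proof -
  \<comment> \<open>This positive null net is the test net for both converse implications.\<close>
  obtain A :: "'i set" and r and \<mu> :: "'i \<Rightarrow> real" where
    A: "index_poset A r" and pos: "\<And>a. a \<in> A \<Longrightarrow> 0 < \<mu> a" and "o1_conv A r \<mu> 0"
    using ex_positive_null_net[OF assms(2)] by blast
  then have \<mu>: "order_conv i A r \<mu> 0" using o1_conv_imp_order_conv assms(1) by blast
  have "?i \<Longrightarrow> ?ii" using order_conv_scaleR by blast
  moreover have "?i \<Longrightarrow> ?iii"
    using order_conv_diag[OF _ order_conv_scaleR] by fastforce
  moreover have "?i" if ii: ?ii
  proof -
    \<comment> \<open>The type \<open>'j\<close> is arbitrary, possibly with one element, so the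
      vector \<open>x\<close> is taken as a net over a single point. The product index set then
      carries the scalars \<open>\<mu> \<circ> fst\<close>, which are still positive.\<close>
    define B where "B = {undefined :: 'j}"
    define s where "s = {(undefined :: 'j, undefined :: 'j)}"
    have B: "index_poset B s" unfolding B_def s_def by (rule index_poset_singleton)
    have "o3_conv (A \<times> B) (prod_order r s) (\<lambda>p. (\<mu> \<circ> fst) p *\<^sub>R x) 0" for x :: 'a
    proof -
      have "order_conv i B s (\<lambda>_. x) x"
        by (rule o1_conv_imp_order_conv[OF B o1_conv_const[OF B] assms(1)])
      then have "order_conv i (A \<times> B) (prod_order r s) (\<lambda>(a, b). \<mu> a *\<^sub>R x) (0 *\<^sub>R x)"
        using ii A B \<mu> by blast
      then show ?thesis
        using order_conv_imp_o3_conv[OF index_poset_prod[OF A B]]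
        by (fastforce simp: split_beta')
    qed
    then show ?i
      by (intro archimedean_directed_if_scaleR_conv[OF index_poset_prod[OF A B], of "\<mu> \<circ> fst"])
        (auto simp: pos)
  qed
  moreover have "?i" if iii: ?iii
  proof -
    have "o3_conv A r (\<lambda>a. \<mu> a *\<^sub>R x) 0" for x :: 'a
    proof -
      \<comment> \<open>With a common index set, the constant net \<open>x\<close> over
        \<open>A\<close> itself takes the place of the one-point net.\<close>
      have "order_conv i A r (\<lambda>_. x) x"
        by (rule o1_conv_imp_order_conv[OF A o1_conv_const[OF A] assms(1)])
      then have "order_conv i A r (\<lambda>a. \<mu> a *\<^sub>R x) (0 *\<^sub>R x)" using iii A \<mu> by blast
      then show ?thesis using order_conv_imp_o3_conv[OF A] by simp
    qed
    then show ?i by (intro archimedean_directed_if_scaleR_conv[OF A, of \<mu>]) (auto simp: pos)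
  qed
  ultimately show ?thesis by blast
qed

end
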